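(* Let $a<b$ and $0<\alpha<1$. Let $p:[a,b]\to\mathbb{R}$ be continuous with $p(t)\ge 0$ on $[a,b]$ and $p(a)\ne 0$. Suppose $u\in H^1(a,b)\cap C[a,b]$ satisfies $$({}^{ABC}{}_{a}D^\alpha u)(t)+p(t)\,u(t)\le 0\qquad\text{for all } t\in(a,b].$$ Then $u(t)\le 0$ for all $t\in[a,b]$.
   Context: All functions are real-valued. $E_\alpha(z)=\sum_{k\ge 0} z^k/\Gamma(\alpha k+1)$ is the Mittag-Leffler function, and $B$ is a normalization function with $B(\alpha)>0$ and $B(0)=B(1)=1$. For $f\in H^1(a,b)$ and $\alpha\in(0,1)$, the left Caputo fractional derivative with Mittag-Leffler non-singular kernel is $$({}^{ABC}{}_{a}D^\alpha f)(t)=\frac{B(\alpha)}{1-\alpha}\int_a^t E_\alpha\!\left[-\frac{\alpha}{1-\alpha}(t-s)^\alpha\right] f'(s)\,ds,\qquad t\in[a,b].$$ *)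

theory Defs
  imports "HOL-Analysis.Analysis"
begin

definition square_integrable_on :: "real set \<Rightarrow> (real \<Rightarrow> real) \<Rightarrow> bool" where
  "square_integrable_on S f \<longleftrightarrow>
     f \<in> borel_measurable (lebesgue_on S) \<and> integrable (lebesgue_on S) (\<lambda>x. (f x)\<^sup>2)"

text \<open>The test functions \<open>C\<^sub>c\<^sup>\<infinity>(a,b)\<close>, extended by zero to the whole line.\<close>

definition test_functions :: "real \<Rightarrow> real \<Rightarrow> (real \<Rightarrow> real) set" where
  "test_functions a b =
     {\<phi>. (\<forall>n. (deriv ^^ n) \<phi> differentiable_on UNIV) \<and>
          compact (closure {x. \<phi> x \<noteq> 0}) \<and> closure {x. \<phi> x \<noteq> 0} \<subseteq> {a<..<b}}"

text \<open>\<open>f\<close> and \<open>g\<close> belong to \<open>L\<^sup>2(a,b)\<close>, and \<open>g\<close> is a weak derivative of \<open>f\<close> on \<open>(a,b)\<close>.\<close>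

definition has_H1_deriv :: "real \<Rightarrow> real \<Rightarrow> (real \<Rightarrow> real) \<Rightarrow> (real \<Rightarrow> real) \<Rightarrow> bool" where
  "has_H1_deriv a b f g \<longleftrightarrow>
     square_integrable_on {a<..<b} f \<and> square_integrable_on {a<..<b} g \<and>
     (\<forall>\<phi>\<in>test_functions a b.
        (LINT x|lebesgue_on {a<..<b}. f x * deriv \<phi> x) =
        - (LINT x|lebesgue_on {a<..<b}. g x * \<phi> x))"

definition H1 :: "real \<Rightarrow> real \<Rightarrow> (real \<Rightarrow> real) set" where
  "H1 a b = {f. \<exists>g. has_H1_deriv a b f g}"

text \<open>A representative of the weak derivative of \<open>f \<in> H1 a b\<close>. It is determined only almost
  everywhere on \<open>(a,b)\<close> and is arbitrary elsewhere, so it should only be used under an integral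
  over a subset of \<open>[a,b]\<close>.\<close>

definition H1_deriv :: "real \<Rightarrow> real \<Rightarrow> (real \<Rightarrow> real) \<Rightarrow> real \<Rightarrow> real" where
  "H1_deriv a b f = (SOME g. has_H1_deriv a b f g)"

definition mittag_leffler :: "real \<Rightarrow> real \<Rightarrow> real" where
  "mittag_leffler \<alpha> z = (\<Sum>k. z ^ k / Gamma (\<alpha> * real k + 1))"

definition normalization_function :: "(real \<Rightarrow> real) \<Rightarrow> bool" where
  "normalization_function B \<longleftrightarrow> (\<forall>\<alpha>\<in>{0..1}. B \<alpha> > 0) \<and> B 0 = 1 \<and> B 1 = 1"

text \<open>The left Caputo derivative of order \<open>\<alpha>\<close> with base point \<open>a\<close>, for \<open>f \<in> H1 a b\<close> and
  \<open>t \<in> [a,b]\<close>. The right end point \<open>b\<close> enters only through the interval on which the weak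
  derivative is taken.\<close>

definition ABC_deriv ::
  "(real \<Rightarrow> real) \<Rightarrow> real \<Rightarrow> real \<Rightarrow> real \<Rightarrow> (real \<Rightarrow> real) \<Rightarrow> real \<Rightarrow> real" where
  "ABC_deriv B \<alpha> a b f t =
     B \<alpha> / (1 - \<alpha>) *
     (LINT s|lebesgue_on {a..t}.
        mittag_leffler \<alpha> (- (\<alpha> / (1 - \<alpha>)) * (t - s) powr \<alpha>) * H1_deriv a b f s)"

end

theory Submission
  imports Defs
begin

text \<open>The kernel \<open>K(x) = E\<^sub>\<alpha>(-\<alpha>/(1-\<alpha>) x powr \<alpha>)\<close> is positive and nonincreasing, because
  \<open>E\<^bsub>\<alpha>,\<beta>\<^esub>\<close> is positive on the negative half-line for \<open>\<alpha> \<le> \<beta>\<close>, and \<open>E\<^sub>\<alpha>' = E\<^bsub>\<alpha>,\<alpha>\<^esub>/\<alpha>\<close>. By the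
  second mean value theorem the derivative at \<open>t\<close> is then a positive multiple of
  \<open>K(t-a) (u(c) - u(a)) + (u(t) - u(c))\<close> for some \<open>c \<in> [a,t]\<close>. It tends to \<open>0\<close> as \<open>t\<close> tends to \<open>a\<close>, so
  \<open>p(a) u(a) \<le> 0\<close> and hence \<open>u(a) \<le> 0\<close>. At a maximum point \<open>t\<close> with \<open>u(t) > 0\<close> the expression is at least
  \<open>K(t-a) (u(t) - u(a)) > 0\<close>, contradicting the differential inequality.\<close>

section \<open>Positivity of the Mittag-Leffler function on the negative half-line\<close>

text \<open>Euler's integral is cut down to \<open>{T..}\<close>, where
  \<open>t powr (x - 1)\<close> is at least \<open>T powr (x - 1)\<close>. As \<open>T\<close> is
  free, Gamma outgrows every geometric sequence.\<close>

lemma Gamma_ge_powr: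
  fixes x T :: real
  assumes "x \<ge> 1" "T > 0"
  shows "T powr (x - 1) * exp (-T) \<le> Gamma x"
proof -
  have "((\<lambda>t. exp (-1 * t)) has_integral exp (-1 * T) / 1) {T..}"
    by (rule has_integral_exp_minus_to_infinity) simp
  then have "((\<lambda>t. T powr (x - 1) * exp (- t)) has_integral T powr (x - 1) * exp (-T)) {T..}"
    by (intro has_integral_mult_right) simp
  then have *: "((\<lambda>t. if t \<in> {T..} then T powr (x - 1) * exp (- t) else 0)
      has_integral T powr (x - 1) * exp (-T)) {0..}"
    using assms by (subst has_integral_restrict) auto
  show ?thesis
  proof (rule has_integral_le[OF * Gamma_integral_real])
    show "(if t \<in> {T..} then T powr (x - 1) * exp (- t) else 0) \<le> t powr (x - 1) / exp t"
      if "t \<in> {0..}" for t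
      using that assms by (auto simp: exp_minus field_simps intro!: powr_mono2)
  qed (use assms in auto)
qed

text \<open>The two-parameter Mittag-Leffler function. The case \<beta> = 1 is the kernel function
  and \<beta> = \<alpha> arises from differentiating it, so one positivity proof covers
  both.\<close>

definition mittag_leffler2 :: "real \<Rightarrow> real \<Rightarrow> real \<Rightarrow> real" where
  "mittag_leffler2 \<alpha> \<beta> z = (\<Sum>k. z ^ k / Gamma (\<alpha> * real k + \<beta>))"

lemma mittag_leffler_eq: "mittag_leffler \<alpha> = mittag_leffler2 \<alpha> 1"
  by (simp add: fun_eq_iff mittag_leffler_def mittag_leffler2_def)

text \<open>Comparison with a geometric series: Gamma dominates \<open>(T powr \<alpha>) ^ n\<close>
  up to a constant, and \<open>T\<close> can be taken with \<open>T powr \<alpha>\<close> larger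
  than the modulus of \<open>z\<close>.\<close>

lemma summable_mittag_leffler2:
  fixes \<alpha> \<beta> z :: real
  assumes "\<alpha> > 0" "\<beta> > 0"
  shows "summable (\<lambda>k. z ^ k / Gamma (\<alpha> * real k + \<beta>))"
proof -
  \<comment> \<open>Any \<open>T powr \<alpha>\<close> above the modulus of \<open>z\<close> would
    give a ratio \<open>q < 1\<close>; the summand 1 keeps \<open>T\<close> positive when
    \<open>z = 0\<close>.\<close>
  define T where "T = (2 * \<bar>z\<bar> + 1) powr (1 / \<alpha>)"
  have T: "T > 0" by (simp add: T_def add_nonneg_eq_0_iff)
  have Ta: "T powr \<alpha> = 2 * \<bar>z\<bar> + 1" using assms by (simp add: T_def powr_powr)
  define q where "q = \<bar>z\<bar> / (2 * \<bar>z\<bar> + 1)"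
  have q: "0 \<le> q" "q < 1" by (auto simp: q_def field_simps)
  define C where "C = exp T / T powr (\<beta> - 1)"
  \<comment> \<open>From this index on the argument of Gamma is at least 1, as the lower bound for
    Gamma requires.\<close>
  obtain N where N: "real N > 1 / \<alpha>" using reals_Archimedean2 by blast
  show ?thesis
  proof (rule summable_comparison_test)
    show "\<exists>N. \<forall>n\<ge>N. norm (z ^ n / Gamma (\<alpha> * real n + \<beta>)) \<le> C * q ^ n"
    proof (intro exI allI impI)
      fix n assume "n \<ge> N"
      then have "real n > 1 / \<alpha>" using N by linarith
      then have an: "\<alpha> * real n + \<beta> \<ge> 1" using assms by (simp add: field_simps)
      have "T powr (\<alpha> * real n + \<beta> - 1) * exp (-T) = (2 * \<bar>z\<bar> + 1) ^ n / C"
      proof -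
        have "T powr (\<alpha> * real n + \<beta> - 1) = T powr (\<alpha> * real n) * T powr (\<beta> - 1)"
          by (simp add: powr_add[symmetric] add_diff_eq)
        also have "T powr (\<alpha> * real n) = (2 * \<bar>z\<bar> + 1) ^ n"
          using T Ta by (metis powr_powr powr_realpow powr_gt_zero less_irrefl)
        finally show ?thesis by (simp add: C_def exp_minus field_simps)
      qed
      then have G: "(2 * \<bar>z\<bar> + 1) ^ n / C \<le> Gamma (\<alpha> * real n + \<beta>)"
        using Gamma_ge_powr[OF an T] by simp
      have C: "C > 0" using T by (simp add: C_def)
      then have "norm (z ^ n / Gamma (\<alpha> * real n + \<beta>)) = \<bar>z\<bar> ^ n / Gamma (\<alpha> * real n + \<beta>)"
        using an by (simp add: power_abs Gamma_real_pos)
      also have "\<dots> \<le> \<bar>z\<bar> ^ n / ((2 * \<bar>z\<bar> + 1) ^ n / C)"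
        using G C by (intro divide_left_mono mult_pos_pos) (auto intro!: divide_pos_pos mult_pos_pos Gamma_real_pos simp: an less_le_trans[OF zero_less_one an])
      also have "\<dots> = C * q ^ n" by (simp add: q_def power_divide)
      finally show "norm (z ^ n / Gamma (\<alpha> * real n + \<beta>)) \<le> C * q ^ n" .
    qed
    show "summable (\<lambda>n. C * q ^ n)" using q by (intro summable_mult summable_geometric) auto
  qed
qed

lemma mittag_leffler2_0: "mittag_leffler2 \<alpha> \<beta> 0 = 1 / Gamma \<beta>"
proof -
  have "mittag_leffler2 \<alpha> \<beta> 0 = (\<Sum>k. (1 / Gamma (\<alpha> * real k + \<beta>)) * 0 ^ k)"
    by (simp add: mittag_leffler2_def)
  then show ?thesis by (simp only: powser_zero) simp
qed

text \<open>Serves to establish continuity, hence the existential form.\<close>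

lemma DERIV_mittag_leffler2:
  fixes \<alpha> \<beta> z :: real
  assumes "\<alpha> > 0" "\<beta> > 0"
  shows "\<exists>D. (mittag_leffler2 \<alpha> \<beta> has_real_derivative D) (at z)"
proof -
  define c where "c = (\<lambda>k. 1 / Gamma (\<alpha> * real k + \<beta>))"
  have "((\<lambda>x. \<Sum>n. c n * x ^ n) has_real_derivative (\<Sum>n. diffs c n * z ^ n)) (at z)"
    using summable_mittag_leffler2[OF assms]
    by (intro termdiffs_strong_converges_everywhere) (simp add: c_def)
  then show ?thesis by (auto simp: c_def mittag_leffler2_def[abs_def])
qed

text \<open>Termwise differentiation: the factor \<open>Suc n\<close> cancels against the one split
  off by the functional equation of Gamma at \<open>\<alpha> * Suc n\<close>, leaving
  \<open>1 / \<alpha>\<close>.\<close>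

lemma DERIV_mittag_leffler:
  fixes \<alpha> z :: real
  assumes "\<alpha> > 0"
  shows "(mittag_leffler \<alpha> has_real_derivative mittag_leffler2 \<alpha> \<alpha> z / \<alpha>) (at z)"
proof -
  define c where "c = (\<lambda>k. 1 / Gamma (\<alpha> * real k + 1))"
  have "((\<lambda>x. \<Sum>n. c n * x ^ n) has_real_derivative (\<Sum>n. diffs c n * z ^ n)) (at z)"
    using summable_mittag_leffler2[OF assms, of 1]
    by (intro termdiffs_strong_converges_everywhere) (simp add: c_def)
  moreover have "diffs c n * z ^ n = (z ^ n / Gamma (\<alpha> * real n + \<alpha>)) / \<alpha>" for n
  proof -
    have "\<alpha> * real (Suc n) > 0" using assms by simp
    then have "Gamma (\<alpha> * real (Suc n) + 1) = \<alpha> * real (Suc n) * Gamma (\<alpha> * real (Suc n))"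
      by (intro Gamma_plus1) (auto simp: nonpos_Ints_def)
    then show ?thesis
      using assms by (simp add: diffs_def c_def field_simps del: of_nat_Suc) (simp add: algebra_simps)
  qed
  ultimately show ?thesis
    using suminf_divide[OF summable_mittag_leffler2[OF assms assms, of z], of \<alpha>]
    by (simp add: c_def mittag_leffler_def[abs_def] mittag_leffler2_def)
qed

lemma continuous_on_mittag_leffler2_powr:
  fixes \<alpha> \<beta> :: real
  assumes "\<alpha> > 0" "\<beta> > 0"
  shows "continuous_on {0..} (\<lambda>x. mittag_leffler2 \<alpha> \<beta> (- (x powr \<alpha>)))"
proof -
  have "continuous_on UNIV (mittag_leffler2 \<alpha> \<beta>)"
    using DERIV_mittag_leffler2[OF assms] DERIV_isCont by (metis continuous_at_imp_continuous_on)
  moreover have "continuous_on {0..} (\<lambda>x::real. - (x powr \<alpha>))"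
    using assms by (intro continuous_intros continuous_on_powr') auto
  ultimately show ?thesis
    using continuous_on_compose2 by blast
qed

section \<open>Beta integrals and the Volterra equation\<close>

text \<open>The Beta integral on the unit interval, stretched by the factor
  \<open>x\<close>.\<close>

lemma has_integral_Beta_scaled:
  fixes a b x :: real
  assumes "a > 0" "b > 0" "x > 0"
  shows "((\<lambda>s. s powr (a - 1) * (x - s) powr (b - 1)) has_integral
           x powr (a + b - 1) * Beta a b) {0..x}"
proof -
  have "((\<lambda>s. (1/x * s) powr (a - 1) * (1 - 1/x * s) powr (b - 1)) has_integral
      (1 / \<bar>1/x\<bar>) *\<^sub>R Beta a b) ((\<lambda>s. s / (1/x)) ` {0..1})"
    using assms by (intro has_integral_stretch_real has_integral_Beta_real) auto
  moreover have "(\<lambda>s. s / (1/x)) ` {0..1} = {0..x}"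
    using assms by (auto simp: image_iff field_simps intro!: bexI[of _ "_ / x"])
  ultimately have "((\<lambda>s. (1/x * s) powr (a - 1) * (1 - 1/x * s) powr (b - 1)) has_integral
      x * Beta a b) {0..x}" using assms by simp
  then have "((\<lambda>s. x powr (a + b - 2) * ((1/x * s) powr (a - 1) * (1 - 1/x * s) powr (b - 1)))
      has_integral x powr (a + b - 2) * (x * Beta a b)) {0..x}"
    by (rule has_integral_mult_right)
  moreover have "x powr (a + b - 2) * (x * Beta a b) = x powr (a + b - 1) * Beta a b"
    using assms powr_add[of x "a + b - 2" 1] by simp
  moreover have "x powr (a + b - 2) * ((1/x * s) powr (a - 1) * (1 - 1/x * s) powr (b - 1)) =
      s powr (a - 1) * (x - s) powr (b - 1)" if "s \<in> {0..x}" for s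
  proof -
    have "1 - 1/x * s = (x - s) / x" using assms by (simp add: field_simps)
    moreover have "x powr (a + b - 2) = x powr (a - 1) * x powr (b - 1)"
      by (simp add: powr_add[symmetric])
    ultimately show ?thesis using that assms by (simp add: powr_divide)
  qed
  ultimately show ?thesis
    using has_integral_cong[of "{0..x}"] by (metis (no_types, lifting))
qed

text \<open>The Volterra equation of \<open>f(x) = x powr (\<beta> - 1) * E\<^bsub>\<alpha>,\<beta>\<^esub>(-x powr \<alpha>)\<close>, obtained by
  integrating the series term by term with the Beta integral.\<close>

lemma mittag_leffler2_Volterra:
  fixes \<alpha> \<beta> x :: real
  assumes "\<alpha> > 0" "\<beta> > 0" "x > 0"
  shows "((\<lambda>s. s powr (\<beta> - 1) * (x - s) powr (\<alpha> - 1) * mittag_leffler2 \<alpha> \<beta> (- (s powr \<alpha>)))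
    has_integral Gamma \<alpha> * x powr (\<beta> - 1) * (1 / Gamma \<beta> - mittag_leffler2 \<alpha> \<beta> (- (x powr \<alpha>)))) {0..x}"
proof -
  define M where "M = lebesgue_on {0..x}"
  define h where "h = (\<lambda>k s. s powr (\<alpha> * real k + \<beta> - 1) * (x - s) powr (\<alpha> - 1))"
  define f where "f = (\<lambda>k s. (-1) ^ k / Gamma (\<alpha> * real k + \<beta>) * h k s)"
  \<comment> \<open>The integral of the absolute value of \<open>f k\<close>. In the Beta integral
    \<open>Gamma (\<alpha> * k + \<beta>)\<close> cancels, and the kernel raises the exponent by
    \<alpha>, which shifts the index to \<open>Suc k\<close>.\<close>
  define a where "a = (\<lambda>k. x powr (\<alpha> * real (Suc k) + \<beta> - 1) * Gamma \<alpha> / Gamma (\<alpha> * real (Suc k) + \<beta>))"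
  have pos: "\<alpha> * real k + \<beta> > 0" for k using assms by (simp add: add_nonneg_pos)
  have Gpos: "Gamma (\<alpha> * real k + \<beta>) > 0" for k using pos by (rule Gamma_real_pos)
  have xp: "x powr (\<alpha> * real k) = (x powr \<alpha>) ^ k" if "x > 0" for x :: real and k
    using that by (simp add: powr_powr[symmetric] powr_realpow)
  have hint: "(h k has_integral a k * Gamma (\<alpha> * real k + \<beta>)) {0..x}" for k
  proof -
    have "(h k has_integral x powr (\<alpha> * real k + \<beta> + \<alpha> - 1) * Beta (\<alpha> * real k + \<beta>) \<alpha>) {0..x}"
      unfolding h_def using pos assms by (intro has_integral_Beta_scaled)
    then show ?thesis by (simp add: a_def Beta_def rGamma_inverse_Gamma field_simps)
  qed
  have hnn: "h k s \<ge> 0" for k s by (simp add: h_def)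
  have habs: "h k absolutely_integrable_on {0..x}" for k
    using hint hnn by (intro nonnegative_absolutely_integrable_1) auto
  then have hi: "integrable M (h k)" for k
    unfolding M_def by (intro absolutely_integrable_imp_integrable) auto
  have hL: "integral\<^sup>L M (h k) = a k * Gamma (\<alpha> * real k + \<beta>)" for k
    using hint hi unfolding M_def by (subst lebesgue_integral_eq_integral) auto
  have fi: "integrable M (f k)" for k unfolding f_def using hi by auto
  have fL: "integral\<^sup>L M (f k) = (-1) ^ k * a k" for k
    using Gpos[of k] by (simp add: f_def hL)
  have fN: "(\<integral>s. norm (f k s) \<partial>M) = a k" for k
    using Gpos[of k] hnn by (simp add: f_def hL abs_mult)
  have faeq: "f k s = s powr (\<beta> - 1) * (x - s) powr (\<alpha> - 1) * ((- (s powr \<alpha>)) ^ k / Gamma (\<alpha> * real k + \<beta>))"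
    if "s \<in> {0..x}" for k s
  \<comment> \<open>At \<open>s = 0\<close> both sides vanish because \<open>0 powr r = 0\<close>
    for every \<open>r\<close>.\<close>
  proof (cases "s = 0")
    case False
    then have "s > 0" using that by auto
    then have "s powr (\<alpha> * real k + \<beta> - 1) = s powr (\<beta> - 1) * (s powr \<alpha>) ^ k"
      using xp[of s k] powr_add[of s "\<beta> - 1" "\<alpha> * real k"] by (simp add: algebra_simps)
    then show ?thesis by (simp add: f_def h_def power_minus[of "s powr \<alpha>"])
  qed (simp add: f_def h_def)
  have sa: "a k = (Gamma \<alpha> * x powr (\<beta> - 1)) * ((x powr \<alpha>) ^ Suc k / Gamma (\<alpha> * real (Suc k) + \<beta>))" for k
  proof -
    have "x powr (\<alpha> * real (Suc k) + \<beta> - 1) = x powr (\<beta> - 1) * (x powr \<alpha>) ^ Suc k"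
    proof -
      have "\<alpha> * real (Suc k) + \<beta> - 1 = (\<beta> - 1) + \<alpha> * real (Suc k)" by simp
      then show ?thesis using xp[OF assms(3), of "Suc k"] by (simp only: powr_add)
    qed
    then show ?thesis by (simp only: a_def mult_ac times_divide_eq_right)
  qed
  have sg: "(-1) ^ k * a k = - (Gamma \<alpha> * x powr (\<beta> - 1)) *
      ((- (x powr \<alpha>)) ^ Suc k / Gamma (\<alpha> * real (Suc k) + \<beta>))" for k
    unfolding sa power_minus[of "x powr \<alpha>" "Suc k"] by simp
  have S: "summable (\<lambda>k. (x powr \<alpha>) ^ Suc k / Gamma (\<alpha> * real (Suc k) + \<beta>))"
    by (rule summable_Suc_iff[THEN iffD2, OF summable_mittag_leffler2[OF assms(1,2)]])
  have suma: "summable a" unfolding sa by (intro summable_mult S)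
  have sumnorm: "AE s in M. summable (\<lambda>k. norm (f k s))"
  proof (rule AE_I2)
    fix s assume "s \<in> space M"
    then have s: "s \<in> {0..x}" by (simp add: M_def)
    have "norm (f k s) = s powr (\<beta> - 1) * (x - s) powr (\<alpha> - 1) * ((s powr \<alpha>) ^ k / Gamma (\<alpha> * real k + \<beta>))" for k
      unfolding faeq[OF s] using Gpos[of k] by (simp add: abs_mult power_abs)
    then show "summable (\<lambda>k. norm (f k s))"
      using summable_mittag_leffler2[OF assms(1,2)] by (simp only:) (intro summable_mult)
  qed
  \<comment> \<open>Summability of the integrals of the absolute values is what permits exchanging
    sum and integral.\<close>
  have sn2: "summable (\<lambda>k. \<integral>s. norm (f k s) \<partial>M)" unfolding fN by (rule suma)
  note series = fi sumnorm sn2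
  have sums: "(\<lambda>k. integral\<^sup>L M (f k)) sums (\<integral>s. (\<Sum>k. f k s) \<partial>M)"
    by (rule sums_integral[OF series])
  have "((\<lambda>s. \<Sum>k. f k s) has_integral (\<integral>s. (\<Sum>k. f k s) \<partial>M)) {0..x}"
    using integrable_suminf[OF series] unfolding M_def by (intro has_integral_integral_lebesgue_on) auto
  moreover have "(\<integral>s. (\<Sum>k. f k s) \<partial>M) =
      Gamma \<alpha> * x powr (\<beta> - 1) * (1 / Gamma \<beta> - mittag_leffler2 \<alpha> \<beta> (- (x powr \<alpha>)))"
  proof -
    have S1: "summable (\<lambda>k. (- (x powr \<alpha>)) ^ k / Gamma (\<alpha> * real k + \<beta>))"
      by (rule summable_mittag_leffler2[OF assms(1,2)])
    \<comment> \<open>The integrated series starts at index 1; the missing zeroth term is the source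
      of \<open>1 / Gamma \<beta>\<close>.\<close>
    have "(\<lambda>k. (- (x powr \<alpha>)) ^ Suc k / Gamma (\<alpha> * real (Suc k) + \<beta>)) sums
        (mittag_leffler2 \<alpha> \<beta> (- (x powr \<alpha>)) - (- (x powr \<alpha>)) ^ 0 / Gamma (\<alpha> * real 0 + \<beta>))"
      using summable_sums[OF S1] unfolding mittag_leffler2_def
      by (subst sums_Suc_iff) simp
    from sums_mult[OF this, of "- (Gamma \<alpha> * x powr (\<beta> - 1))"]
    have "(\<lambda>k. integral\<^sup>L M (f k)) sums (- (Gamma \<alpha> * x powr (\<beta> - 1)) *
        (mittag_leffler2 \<alpha> \<beta> (- (x powr \<alpha>)) - (- (x powr \<alpha>)) ^ 0 / Gamma (\<alpha> * real 0 + \<beta>)))"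
      unfolding fL sg .
    then show ?thesis using sums sums_unique2 by (fastforce simp: algebra_simps)
  qed
  moreover have "(\<Sum>k. f k s) = s powr (\<beta> - 1) * (x - s) powr (\<alpha> - 1) * mittag_leffler2 \<alpha> \<beta> (- (s powr \<alpha>))"
    if "s \<in> {0..x}" for s
    unfolding faeq[OF that] mittag_leffler2_def
    by (rule suminf_mult[OF summable_mittag_leffler2[OF assms(1,2)]])
  ultimately show ?thesis
    using has_integral_cong[of "{0..x}"] by (metis (no_types, lifting))
qed

section \<open>Positivity by a first-zero argument, and monotonicity\<close>

text \<open>For \<open>a < 1\<close> the integrand is unbounded near \<open>y\<close>, but its
  antiderivative is continuous up to \<open>y\<close>, so the fundamental theorem with derivatives
  only in the interior applies.\<close>

lemma has_integral_powr_diff: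
  fixes x y a :: real
  assumes "a > 0" "x \<le> y"
  shows "((\<lambda>s. (y - s) powr (a - 1)) has_integral (y - x) powr a / a) {x..y}"
proof -
  have "((\<lambda>s. (y - s) powr (a - 1)) has_integral (- ((y - y) powr a / a)) - (- ((y - x) powr a / a))) {x..y}"
  proof (rule fundamental_theorem_of_calculus_interior[OF assms(2)])
    show "continuous_on {x..y} (\<lambda>s. - ((y - s) powr a / a))"
      using assms by (intro continuous_intros continuous_on_powr') auto
    show "((\<lambda>s. - ((y - s) powr a / a)) has_vector_derivative (y - s) powr (a - 1)) (at s)"
      if "s \<in> {x<..<y}" for s
      using that assms unfolding has_real_derivative_iff_has_vector_derivative[symmetric]
      by (auto intro!: derivative_eq_intros simp: field_simps powr_diff)
  qed
  then show ?thesis by simp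
qed

text \<open>At a first zero \<open>x\<^sub>0\<close>, the Volterra equations at \<open>x\<^sub>0\<close> and at \<open>x < x\<^sub>0\<close> have kernels which,
  normalised by the inhomogeneity, decrease in the base point. Subtracting them bounds the value at
  \<open>x\<close> by an integral over \<open>[x,x\<^sub>0]\<close>, which is impossible at a maximum point close to \<open>x\<^sub>0\<close>.\<close>

lemma mittag_leffler2_powr_pos:
  fixes \<alpha> \<beta> y :: real
  assumes "0 < \<alpha>" "\<alpha> \<le> 1" "\<alpha> \<le> \<beta>" "y \<ge> 0"
  shows "mittag_leffler2 \<alpha> \<beta> (- (y powr \<alpha>)) > 0"
proof (rule ccontr)
  assume neg: "\<not> ?thesis"
  define g where "g = (\<lambda>x. mittag_leffler2 \<alpha> \<beta> (- (x powr \<alpha>)))"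
  have \<beta>: "\<beta> > 0" using assms by simp
  have G: "Gamma \<alpha> > 0" "Gamma \<beta> > 0" using assms \<beta> by (auto intro: Gamma_real_pos)
  have cont: "continuous_on {0..} g"
    unfolding g_def by (rule continuous_on_mittag_leffler2_powr) (use assms \<beta> in auto)
  have g0: "g 0 > 0" using G by (simp add: g_def mittag_leffler2_0)
  \<comment> \<open>Compactness makes the infimum of the points with \<open>g \<le> 0\<close> a
    member \<open>x0\<close>, and \<open>g\<close> is positive before it.\<close>
  define Z where "Z = {0..y} \<inter> g -` {..0}"
  have "closed Z" unfolding Z_def
    by (intro continuous_closed_preimage continuous_on_subset[OF cont]) auto
  then have "compact Z" unfolding compact_eq_bounded_closed
    by (auto simp: Z_def intro: bounded_subset[of "{0..y}"])
  moreover have "y \<in> Z" using neg assms by (auto simp: Z_def g_def)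
  ultimately obtain x0 where "x0 \<in> Z" and min: "\<And>x. x \<in> Z \<Longrightarrow> x0 \<le> x"
    using compact_attains_inf[of Z] by blast
  then have gx0: "g x0 \<le> 0" and "x0 \<ge> 0" "x0 \<le> y" by (auto simp: Z_def)
  with g0 have x0: "x0 > 0" by (cases "x0 = 0") auto
  have gpos: "g x > 0" if "0 \<le> x" "x < x0" for x
    using min[of x] that \<open>x0 \<le> y\<close> by (force simp: Z_def)
  \<comment> \<open>The Volterra kernel divided by \<open>x powr (\<beta> - 1)\<close>, so that the
    right-hand side depends on \<open>x\<close> only through \<open>g x\<close>.\<close>
  define k where "k = (\<lambda>x s. s powr (\<beta> - 1) * (x - s) powr (\<alpha> - 1) * x powr (1 - \<beta>))"
  have V: "((\<lambda>s. k x s * g s) has_integral Gamma \<alpha> * (1 / Gamma \<beta> - g x)) {0..x}" if "x > 0" for x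
  proof -
    have "x powr (1 - \<beta>) * x powr (\<beta> - 1) = 1" using that by (simp add: powr_add[symmetric])
    moreover have "x powr (1 - \<beta>) * (Gamma \<alpha> * x powr (\<beta> - 1) * r) =
        x powr (1 - \<beta>) * x powr (\<beta> - 1) * (Gamma \<alpha> * r)" for r
      by (simp only: mult_ac)
    ultimately have "x powr (1 - \<beta>) * (Gamma \<alpha> * x powr (\<beta> - 1) * r) = Gamma \<alpha> * r" for r
      by simp
    moreover have "k x s * g s = x powr (1 - \<beta>) * (s powr (\<beta> - 1) * (x - s) powr (\<alpha> - 1) * g s)" for s
      by (simp add: k_def mult_ac)
    ultimately show ?thesis
      using has_integral_mult_right[OF mittag_leffler2_Volterra[OF assms(1) \<beta> that], of "x powr (1 - \<beta>)"]
      by (simp only: g_def)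
  qed
  have kmono: "k x0 s \<le> k x s" if "0 < s" "s < x" "x < x0" for s x
  proof -
    \<comment> \<open>In this factorisation \<open>(z - s) / z\<close> increases with
      \<open>z\<close> while both exponents \<open>\<alpha> - 1\<close> and
      \<open>\<alpha> - \<beta>\<close> are at most 0, so \<open>k z s\<close> decreases in
      \<open>z\<close>.\<close>
    have eq: "k z s = s powr (\<beta> - 1) * (((z - s) / z) powr (\<alpha> - 1) * z powr (\<alpha> - \<beta>))" if "s < z" for z
    proof -
      have "z powr (\<alpha> - \<beta>) = z powr (\<alpha> - 1) * z powr (1 - \<beta>)"
        by (simp add: powr_add[symmetric])
      then show ?thesis using that \<open>0 < s\<close> by (simp add: k_def powr_divide)
    qed
    have "(x - s) / x \<le> (x0 - s) / x0" using that x0 by (simp add: field_simps)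
    then show ?thesis using that assms unfolding eq[OF that(2)] eq[OF less_trans[OF that(2,3)]]
      by (intro mult_left_mono mult_mono powr_mono2') auto
  qed
  have kbound: "k x0 s \<le> 2 * (x0 - s) powr (\<alpha> - 1)" if "x0 / 2 \<le> s" "s \<le> x0" for s
  proof -
    \<comment> \<open>Here \<open>s / x0\<close> lies in [1/2, 1] and
      \<open>\<beta> - 1 > -1\<close>, which yields the constant 2.\<close>
    have "(s / x0) powr (\<beta> - 1) \<le> (s / x0) powr (-1)"
      using that x0 \<beta> by (intro powr_mono') auto
    also have "\<dots> \<le> 2" using that x0 by (simp add: powr_minus field_simps)
    finally have "(s / x0) powr (\<beta> - 1) * (x0 - s) powr (\<alpha> - 1) \<le> 2 * (x0 - s) powr (\<alpha> - 1)"
      by (intro mult_right_mono) auto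
    moreover have "(s / x0) powr (\<beta> - 1) = s powr (\<beta> - 1) * x0 powr (1 - \<beta>)"
    proof -
      have "x0 powr (1 - \<beta>) = inverse (x0 powr (\<beta> - 1))" using powr_minus[of x0 "\<beta> - 1"] by (simp only: minus_diff_eq)
      moreover have "(s / x0) powr (\<beta> - 1) = s powr (\<beta> - 1) / x0 powr (\<beta> - 1)"
        using that x0 by (simp add: powr_divide)
      ultimately show ?thesis by (simp only: divide_inverse)
    qed
    ultimately show ?thesis by (simp add: k_def mult_ac)
  qed
  have key: "Gamma \<alpha> * g x \<le> 2 * M * ((x0 - x) powr \<alpha> / \<alpha>)"
    if x: "x0 / 2 \<le> x" "x < x0" and M: "\<And>s. s \<in> {x..x0} \<Longrightarrow> g s \<le> M" for x M
  proof -
    have "x > 0" using x x0 by linarith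
    have int: "(\<lambda>s. k x0 s * g s) integrable_on {0..x0}" using V[OF x0] by blast
    have int1: "(\<lambda>s. k x0 s * g s) integrable_on {0..x}" "(\<lambda>s. k x0 s * g s) integrable_on {x..x0}"
      using x \<open>x > 0\<close> by (auto intro!: integrable_on_subinterval[OF int])
    have "integral {0..x} (\<lambda>s. k x0 s * g s) \<le> integral {0..x} (\<lambda>s. k x s * g s)"
      \<comment> \<open>The comparison fails at \<open>s = x\<close>, where \<open>k x x = 0\<close>
        by the convention for \<open>0 powr r\<close>; passing to the open interval removes that
        point.\<close>
      unfolding integral_open_interval_real
    proof (rule integral_le)
      show "(\<lambda>s. k x s * g s) integrable_on {0<..<x}"
        using V[OF \<open>x > 0\<close>] unfolding integrable_on_open_interval_real by blast
      show "k x0 s * g s \<le> k x s * g s" if "s \<in> {0<..<x}" for s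
        using that x kmono gpos[of s] by (intro mult_right_mono) auto
    qed (use int1 in \<open>simp add: integrable_on_open_interval_real\<close>)
    moreover have "integral {x..x0} (\<lambda>s. k x0 s * g s) \<le> 2 * M * ((x0 - x) powr \<alpha> / \<alpha>)"
    proof (rule integral_le[THEN order_trans])
      have I: "((\<lambda>s. 2 * M * (x0 - s) powr (\<alpha> - 1)) has_integral 2 * M * ((x0 - x) powr \<alpha> / \<alpha>)) {x..x0}"
        using assms x by (intro has_integral_mult_right has_integral_powr_diff) auto
      show "(\<lambda>s. 2 * M * (x0 - s) powr (\<alpha> - 1)) integrable_on {x..x0}"
        "integral {x..x0} (\<lambda>s. 2 * M * (x0 - s) powr (\<alpha> - 1)) \<le> 2 * M * ((x0 - x) powr \<alpha> / \<alpha>)"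
        using I integral_unique[OF I] by (blast, simp only: order_refl)
      show "k x0 s * g s \<le> 2 * M * (x0 - s) powr (\<alpha> - 1)" if s: "s \<in> {x..x0}" for s
      proof (cases "s = x0")
        case True then show ?thesis by (simp add: k_def)
      next
        case False
        then have "g s \<ge> 0" using gpos[of s] s \<open>x > 0\<close> by auto
        then have "k x0 s * g s \<le> (2 * (x0 - s) powr (\<alpha> - 1)) * M"
          using kbound[of s] M[OF s] s x by (intro mult_mono) auto
        then show ?thesis by (simp add: mult_ac)
      qed
    qed (use int1 in auto)
    moreover have "integral {0..x} (\<lambda>s. k x0 s * g s) + integral {x..x0} (\<lambda>s. k x0 s * g s)
        = Gamma \<alpha> * (1 / Gamma \<beta> - g x0)"
      using Henstock_Kurzweil_Integration.integral_combine[OF _ _ int, of x] integral_unique[OF V[OF x0]] x \<open>x > 0\<close> by simp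
    moreover have "integral {0..x} (\<lambda>s. k x s * g s) = Gamma \<alpha> * (1 / Gamma \<beta> - g x)"
      using integral_unique[OF V[OF \<open>x > 0\<close>]] .
    moreover have "Gamma \<alpha> * (1 / Gamma \<beta> - g x0) \<ge> Gamma \<alpha> * (1 / Gamma \<beta>)"
      using G gx0 by (intro mult_left_mono) auto
    ultimately show ?thesis by (simp add: right_diff_distrib)
  qed
  \<comment> \<open>Chosen so that \<open>2 * M * (\<epsilon> powr \<alpha> / \<alpha>)\<close> is
    half of \<open>Gamma \<alpha> * M\<close>; with \<open>M = g x1\<close> the maximal value,
    \<open>key\<close> is then violated.\<close>
  define \<epsilon> where "\<epsilon> = (\<alpha> * Gamma \<alpha> / 4) powr (1 / \<alpha>)"
  have \<epsilon>: "\<epsilon> > 0" "\<epsilon> powr \<alpha> = \<alpha> * Gamma \<alpha> / 4"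
  proof -
    have "\<alpha> * Gamma \<alpha> / 4 > 0" using G assms by simp
    then show "\<epsilon> > 0" unfolding \<epsilon>_def powr_gt_zero by (metis less_irrefl)
    show "\<epsilon> powr \<alpha> = \<alpha> * Gamma \<alpha> / 4"
      using \<open>\<alpha> * Gamma \<alpha> / 4 > 0\<close> assms by (simp add: \<epsilon>_def powr_powr)
  qed
  \<comment> \<open>Within \<epsilon> of \<open>x0\<close>, but not below \<open>x0 / 2\<close>,
    where \<open>key\<close> starts to hold.\<close>
  define w where "w = x0 - min (x0 / 2) \<epsilon>"
  have w: "x0 / 2 \<le> w" "w < x0" "x0 - w \<le> \<epsilon>" using x0 \<epsilon> by (auto simp: w_def)
  have "continuous_on {w..x0} g" by (rule continuous_on_subset[OF cont]) (use w x0 in auto)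
  then obtain x1 where x1: "x1 \<in> {w..x0}" and max: "\<And>s. s \<in> {w..x0} \<Longrightarrow> g s \<le> g x1"
    using continuous_attains_sup[of "{w..x0}" g] w by auto
  have gw: "g w > 0" using gpos[of w] w x0 by auto
  then have pos: "g x1 > 0" using max[of w] w by simp
  then have "x1 < x0" using gx0 x1 by (cases "x1 = x0") auto
  then have "Gamma \<alpha> * g x1 \<le> 2 * g x1 * ((x0 - x1) powr \<alpha> / \<alpha>)"
    using x1 w max by (intro key) auto
  also have "\<dots> \<le> 2 * g x1 * (\<epsilon> powr \<alpha> / \<alpha>)"
    using pos x1 w assms \<open>x1 < x0\<close> by (intro mult_left_mono divide_right_mono powr_mono2) auto
  also have "\<dots> = Gamma \<alpha> * g x1 / 2" using assms by (simp add: \<epsilon>)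
  finally show False using mult_pos_pos[OF G(1) pos] by linarith
qed

text \<open>Every \<open>z \<le> 0\<close> has the form \<open>- (y powr \<alpha>)\<close> with
  \<open>y = (- z) powr (1 / \<alpha>)\<close>.\<close>

lemma mittag_leffler2_pos:
  fixes \<alpha> \<beta> z :: real
  assumes "0 < \<alpha>" "\<alpha> \<le> 1" "\<alpha> \<le> \<beta>" "z \<le> 0"
  shows "mittag_leffler2 \<alpha> \<beta> z > 0"
  using mittag_leffler2_powr_pos[OF assms(1-3), of "(- z) powr (1 / \<alpha>)"] assms by (simp add: powr_powr)

lemma mittag_leffler_pos:
  fixes \<alpha> z :: real
  assumes "0 < \<alpha>" "\<alpha> \<le> 1" "z \<le> 0"
  shows "mittag_leffler \<alpha> z > 0"
  using mittag_leffler2_pos[of \<alpha> 1 z] assms by (simp add: mittag_leffler_eq)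

lemma mittag_leffler_mono:
  fixes \<alpha> y z :: real
  assumes "0 < \<alpha>" "\<alpha> \<le> 1" "y \<le> z" "z \<le> 0"
  shows "mittag_leffler \<alpha> y \<le> mittag_leffler \<alpha> z"
proof (rule DERIV_nonneg_imp_nondecreasing[OF assms(3)])
  fix x assume "y \<le> x" "x \<le> z"
  then show "\<exists>D. (mittag_leffler \<alpha> has_real_derivative D) (at x) \<and> 0 \<le> D"
    using DERIV_mittag_leffler[of \<alpha> x] mittag_leffler2_pos[of \<alpha> \<alpha> x] assms
    by (intro exI[of _ "mittag_leffler2 \<alpha> \<alpha> x / \<alpha>"]) auto
qed

section \<open>Functions with a square integrable weak derivative\<close>

text \<open>This class is closed under differentiation, so all its members are \<open>C\<^sup>\<infinity>\<close>.\<close>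

inductive smooth_fun :: "(real \<Rightarrow> real) \<Rightarrow> bool" where
  exp_inv: "smooth_fun (\<lambda>x. if x > 0 then (1 / x) ^ n * exp (- (1 / x)) else 0)"
| const: "smooth_fun (\<lambda>x. c)"
| affine: "smooth_fun f \<Longrightarrow> smooth_fun (\<lambda>x. f (c * x + d))"
| add: "smooth_fun f \<Longrightarrow> smooth_fun g \<Longrightarrow> smooth_fun (\<lambda>x. f x + g x)"
| mult: "smooth_fun f \<Longrightarrow> smooth_fun g \<Longrightarrow> smooth_fun (\<lambda>x. f x * g x)"
| antideriv: "smooth_fun f \<Longrightarrow> (\<And>x. (F has_real_derivative f x) (at x)) \<Longrightarrow> smooth_fun F"

text \<open>Away from 0 this is the product rule. At 0 the right difference quotient is
  \<open>y ^ Suc n / exp y\<close> with \<open>y = 1 / h\<close> tending to infinity, so the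
  exponential wins.\<close>

lemma DERIV_exp_inv:
  fixes x :: real and n :: nat
  defines "Q \<equiv> \<lambda>n x::real. if x > 0 then (1 / x) ^ n * exp (- (1 / x)) else 0"
  shows "(Q n has_real_derivative - real n * Q (Suc n) x + Q (n + 2) x) (at x)"
proof (cases x "0 :: real" rule: linorder_cases)
  case less
  have "((\<lambda>x. 0) has_real_derivative 0) (at x)" by simp
  then have "(Q n has_real_derivative 0) (at x)"
    by (rule has_field_derivative_transform_within_open[of _ _ _ "{..<0}"]) (use less in \<open>auto simp: Q_def\<close>)
  then show ?thesis using less by (simp add: Q_def)
next
  case greater
  have d: "((\<lambda>x. 1 / x) has_real_derivative - ((1 / x)\<^sup>2)) (at x)"
    using greater by (auto intro!: derivative_eq_intros simp: power2_eq_square)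
  have e: "((\<lambda>x. exp (- (1 / x))) has_real_derivative exp (- (1 / x)) * (1 / x)\<^sup>2) (at x)"
    using greater by (auto intro!: derivative_eq_intros simp: power2_eq_square)
  have "real n * (- y\<^sup>2 * y ^ (n - Suc 0)) * E + E * y\<^sup>2 * y ^ n =
      - real n * (y ^ Suc n * E) + y ^ (n + 2) * E" for y E :: real
    by (cases n) (simp_all add: algebra_simps power2_eq_square)
  from this[of "1 / x" "exp (- (1 / x))"] DERIV_mult[OF DERIV_power[OF d, of n] e]
  have "((\<lambda>x. (1 / x) ^ n * exp (- (1 / x))) has_real_derivative
      - real n * Q (Suc n) x + Q (n + 2) x) (at x)"
    using greater by (simp only: Q_def if_True)
  then show ?thesis
    by (rule has_field_derivative_transform_within_open[of _ _ _ "{0<..}"]) (use greater in \<open>auto simp: Q_def\<close>)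
next
  case equal
  have "((\<lambda>h. (Q n (0 + h) - Q n 0) / h) \<longlongrightarrow> 0) (at 0)"
  proof (rule filterlim_split_at)
    have "eventually (\<lambda>h::real. h < 0) (at_left 0)" by (simp add: eventually_at_filter)
    then show "((\<lambda>h. (Q n (0 + h) - Q n 0) / h) \<longlongrightarrow> 0) (at_left 0)"
      by (intro tendsto_eventually) (auto elim!: eventually_mono simp: Q_def)
    have "((\<lambda>h::real. inverse h ^ Suc n / exp (inverse h)) \<longlongrightarrow> 0) (at_right 0)"
      by (rule filterlim_compose[OF tendsto_power_div_exp_0 filterlim_inverse_at_top_right])
    moreover have "eventually (\<lambda>h::real. inverse h ^ Suc n / exp (inverse h) = (Q n (0 + h) - Q n 0) / h) (at_right 0)"
    proof -
      have "eventually (\<lambda>h::real. h > 0) (at_right 0)" by (simp add: eventually_at_filter)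
      then show ?thesis by eventually_elim (simp add: Q_def exp_minus field_simps)
    qed
    ultimately show "((\<lambda>h. (Q n (0 + h) - Q n 0) / h) \<longlongrightarrow> 0) (at_right 0)"
      by (rule Lim_transform_eventually)
  qed
  then have "(Q n has_real_derivative 0) (at 0)" by (simp only: DERIV_def)
  moreover have "- real n * Q (Suc n) x + Q (n + 2) x = 0" using equal by (simp add: Q_def)
  ultimately show ?thesis by (simp only: equal)
qed

lemma smooth_fun_DERIV:
  assumes "smooth_fun f"
  shows "\<exists>f'. smooth_fun f' \<and> (\<forall>x. (f has_real_derivative f' x) (at x))"
  using assms
proof induction
  case (exp_inv n)
  let ?Q = "\<lambda>n x::real. if x > 0 then (1 / x) ^ n * exp (- (1 / x)) else 0"
  have "smooth_fun (\<lambda>x. - real n * ?Q (Suc n) x + ?Q (n + 2) x)"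
    by (intro smooth_fun.intros)
  then show ?case using DERIV_exp_inv[of n] by blast
next
  case (const c)
  have "smooth_fun (\<lambda>x. 0)" by (rule smooth_fun.const)
  then show ?case by (intro exI[of _ "\<lambda>x. 0"]) auto
next
  case (affine f c d)
  then obtain f' where f': "smooth_fun f'" "\<And>x. (f has_real_derivative f' x) (at x)" by blast
  have "((\<lambda>x. f (c * x + d)) has_real_derivative c * f' (c * x + d)) (at x)" for x
  proof -
    have "((\<lambda>x. c * x + d) has_real_derivative c) (at x)" by (auto intro!: derivative_eq_intros)
    from DERIV_chain2[OF f'(2) this] show ?thesis by (simp add: mult.commute)
  qed
  moreover have "smooth_fun (\<lambda>x. c * f' (c * x + d))"
    by (rule smooth_fun.mult[OF smooth_fun.const smooth_fun.affine[OF f'(1)]])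
  ultimately show ?case by blast
next
  case (add f g)
  then obtain f' g' where "smooth_fun f'" "\<And>x. (f has_real_derivative f' x) (at x)"
    "smooth_fun g'" "\<And>x. (g has_real_derivative g' x) (at x)" by blast
  then show ?case
    by (intro exI[of _ "\<lambda>x. f' x + g' x"]) (auto intro: smooth_fun.add DERIV_add)
next
  case (mult f g)
  then obtain f' g' where "smooth_fun f'" "\<And>x. (f has_real_derivative f' x) (at x)"
    "smooth_fun g'" "\<And>x. (g has_real_derivative g' x) (at x)" by blast
  with mult show ?case
    by (intro exI[of _ "\<lambda>x. f' x * g x + g' x * f x"])
      (auto intro!: smooth_fun.add smooth_fun.mult DERIV_mult)
qed blast

lemma smooth_fun_deriv_funpow:
  assumes "smooth_fun f"
  shows "smooth_fun ((deriv ^^ n) f)"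
proof (induction n)
  case (Suc n)
  then obtain f' where "smooth_fun f'" "\<forall>x. ((deriv ^^ n) f has_real_derivative f' x) (at x)"
    using smooth_fun_DERIV by blast
  moreover from this have "deriv ((deriv ^^ n) f) = f'" by (intro ext DERIV_imp_deriv) auto
  ultimately show ?case by simp
qed (use assms in simp)

lemma smooth_fun_differentiable:
  assumes "smooth_fun f"
  shows "(deriv ^^ n) f differentiable_on UNIV"
  using smooth_fun_DERIV[OF smooth_fun_deriv_funpow[OF assms, of n]]
  by (meson differentiable_at_imp_differentiable_on real_differentiable_def)

lemma smooth_fun_isCont: "smooth_fun f \<Longrightarrow> isCont f x"
  using smooth_fun_DERIV DERIV_isCont by blast

section \<open>Smooth steps and approximate identities\<close>

text \<open>The step is the normalised primitive of the bump
  \<open>exp (- 1 / x) * exp (- 1 / (1 - x))\<close> on (0,1). The rule \<open>antideriv\<close>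
  keeps this primitive in the smooth class.\<close>

lemma smooth_step:
  obtains R R' :: "real \<Rightarrow> real" where "smooth_fun R" "smooth_fun R'"
    "\<And>x. (R has_real_derivative R' x) (at x)" "\<And>x. R' x \<ge> 0"
    "\<And>x. x \<le> 0 \<or> x \<ge> 1 \<Longrightarrow> R' x = 0" "\<And>x. x \<le> 0 \<Longrightarrow> R x = 0" "\<And>x. x \<ge> 1 \<Longrightarrow> R x = 1" "mono R"
proof -
  define Q where "Q = (\<lambda>x::real. if x > 0 then (1 / x) ^ 0 * exp (- (1 / x)) else 0)"
  have Q: "smooth_fun Q" unfolding Q_def by (rule exp_inv)
  \<comment> \<open>Positive exactly on (0,1); the second argument is written as an affine map to
    fit the rule \<open>affine\<close>.\<close>
  define b where "b = (\<lambda>x. Q x * Q (-1 * x + 1))"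
  have b: "smooth_fun b" unfolding b_def by (intro smooth_fun.mult smooth_fun.affine[OF Q] Q)
  have b0: "b x \<ge> 0" "x \<le> 0 \<or> x \<ge> 1 \<Longrightarrow> b x = 0" "0 < x \<Longrightarrow> x < 1 \<Longrightarrow> b x > 0" for x
    by (auto simp: b_def Q_def)
  obtain F where F: "\<And>x. (F has_real_derivative b x) (at x)"
    using einterval_antiderivative[of "-\<infinity>" \<infinity> b] smooth_fun_isCont[OF b]
    by (auto simp: has_real_derivative_iff_has_vector_derivative)
  have mF: "F x \<le> F y" if "x \<le> y" for x y
    using DERIV_nonneg_imp_nondecreasing[OF that, of F] F b0(1) by blast
  have "F 0 < F 1"
    by (rule DERIV_pos_imp_increasing_open)
      (use F b0(3) in \<open>auto intro!: continuous_at_imp_continuous_on DERIV_isCont\<close>)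
  have F0: "F x = F 0" if "x \<le> 0" for x
  proof (rule antisym)
    show "F 0 \<le> F x"
      by (rule DERIV_nonpos_imp_nonincreasing[OF that]) (use F b0(2) that in force)
  qed (rule mF[OF that])
  have F1: "F x = F 1" if "x \<ge> 1" for x
  proof (rule antisym)
    show "F x \<le> F 1"
      by (rule DERIV_nonpos_imp_nonincreasing[OF that]) (use F b0(2) that in force)
  qed (rule mF[OF that])
  define c where "c = 1 / (F 1 - F 0)"
  have c: "c > 0" "c * (F 1 - F 0) = 1" using \<open>F 0 < F 1\<close> by (auto simp: c_def)
  show thesis
  proof (rule that[of "\<lambda>x. c * (F x + (- F 0))" "\<lambda>x. c * b x"])
    show "smooth_fun (\<lambda>x. c * (F x + (- F 0)))"
      by (intro smooth_fun.mult smooth_fun.add smooth_fun.const smooth_fun.antideriv[OF b F])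
    show "smooth_fun (\<lambda>x. c * b x)" by (intro smooth_fun.mult smooth_fun.const b)
    show "((\<lambda>x. c * (F x + - F 0)) has_real_derivative c * b x) (at x)" for x
      by (auto intro!: derivative_eq_intros F)
    show "mono (\<lambda>x. c * (F x + - F 0))" using c mF by (auto intro!: monoI mult_left_mono)
    show "c * (F x + - F 0) = 0" if "x \<le> 0" for x using F0[OF that] by simp
    show "c * (F x + - F 0) = 1" if "x \<ge> 1" for x using F1[OF that] c(2) by simp
  qed (use c b0 in auto)
qed

text \<open>On a bounded interval square integrability implies integrability, since the modulus of
  \<open>y\<close> is at most \<open>1 + y\<^sup>2\<close>.\<close>

lemma has_H1_deriv_absolutely_integrable:
  assumes "has_H1_deriv a b f g"
  shows "g absolutely_integrable_on {a..b}"
proof -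
  have m: "g \<in> borel_measurable (lebesgue_on {a<..<b})"
    and i: "integrable (lebesgue_on {a<..<b}) (\<lambda>x. (g x)\<^sup>2)"
    using assms by (auto simp: has_H1_deriv_def square_integrable_on_def)
  have "integrable (lebesgue_on {a<..<b}) (\<lambda>x. 1 + (g x)\<^sup>2)"
    by (rule Bochner_Integration.integrable_add[OF
          absolutely_integrable_imp_integrable[OF absolutely_integrable_on_const] i]) auto
  then have "integrable (lebesgue_on {a<..<b}) (\<lambda>x. \<bar>g x\<bar>)"
  proof (rule Bochner_Integration.integrable_bound)
    have "\<bar>y\<bar> \<le> 1 + y\<^sup>2" for y :: real
      using zero_le_power2[of "\<bar>y\<bar> - 1"] by (simp add: power2_diff)
    then show "AE x in lebesgue_on {a<..<b}. norm \<bar>g x\<bar> \<le> norm (1 + (g x)\<^sup>2)" by auto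
  qed (use m in measurable)
  then show ?thesis
    using m by (simp add: absolutely_integrable_on_Icc_iff_Ioo absolutely_integrable_measurable_real)
qed

lemma continuous_imp_integrable_Ioo:
  fixes f :: "real \<Rightarrow> real"
  assumes "continuous_on {a..b} f"
  shows "integrable (lebesgue_on {a<..<b}) f"
  using absolutely_integrable_continuous_real[OF assms]
  unfolding absolutely_integrable_on_Icc_iff_Ioo by (rule absolutely_integrable_imp_integrable) simp

text \<open>The weight \<open>R' ((x - s) / \<epsilon> n) / \<epsilon> n\<close> is nonnegative,
  vanishes outside \<open>{s..s + \<epsilon> n}\<close> and eventually has integral 1, so continuity
  of \<open>f\<close> at \<open>s\<close> controls the average.\<close>

lemma tendsto_smooth_step_average:
  fixes f R R' :: "real \<Rightarrow> real" and \<epsilon> :: "nat \<Rightarrow> real"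
  assumes f: "continuous_on {a..b} f" and s: "a < s" "s < b"
    and \<epsilon>: "\<epsilon> \<longlonglongrightarrow> 0" "\<And>n. \<epsilon> n > 0"
    and R: "\<And>x. (R has_real_derivative R' x) (at x)" "\<And>x. R' x \<ge> 0" "\<And>x. isCont R' x"
      "\<And>x. x \<le> 0 \<or> x \<ge> 1 \<Longrightarrow> R' x = 0" "\<And>x. x \<le> 0 \<Longrightarrow> R x = 0" "\<And>x. x \<ge> 1 \<Longrightarrow> R x = 1"
  shows "(\<lambda>n. LINT x|lebesgue_on {a<..<b}. f x * (R' ((x - s) / \<epsilon> n) / \<epsilon> n)) \<longlonglongrightarrow> f s"
proof (rule LIMSEQ_I)
  fix r :: real assume "r > 0"
  have "isCont f s"
    by (rule continuous_on_interior[OF f]) (use s in simp)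
  then have "\<forall>e>0. \<exists>d>0. \<forall>x. \<bar>x - s\<bar> < d \<longrightarrow> \<bar>f x - f s\<bar> < e"
    unfolding continuous_at_eps_delta dist_real_def .
  from this[rule_format, of "r / 2"] \<open>r > 0\<close>
  obtain d where d: "d > 0" "\<And>x. \<bar>x - s\<bar> < d \<Longrightarrow> \<bar>f x - f s\<bar> < r / 2" by auto
  \<comment> \<open>Below \<open>d\<close> the weight sees only points where \<open>f\<close> is
    close to \<open>f s\<close>; below \<open>b - s\<close> its full mass lies in the
    interval.\<close>
  have "eventually (\<lambda>n. \<epsilon> n < min d (b - s)) sequentially"
    by (rule order_tendstoD[OF \<epsilon>(1)]) (use d s in auto)
  then obtain N where N: "\<And>n. n \<ge> N \<Longrightarrow> \<epsilon> n < d \<and> \<epsilon> n < b - s"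
    by (auto simp: eventually_sequentially)
  show "\<exists>N. \<forall>n\<ge>N. norm ((LINT x|lebesgue_on {a<..<b}. f x * (R' ((x - s) / \<epsilon> n) / \<epsilon> n)) - f s) < r"
  proof (intro exI allI impI)
    fix n assume "n \<ge> N"
    define e where "e = \<epsilon> n"
    have e: "e > 0" "e < d" "e < b - s" using N[OF \<open>n \<ge> N\<close>] \<epsilon>(2) by (auto simp: e_def)
    define \<psi> where "\<psi> = (\<lambda>x. R' ((x - s) / e) / e)"
    have "continuous_on UNIV R'" using R(3) by (simp add: continuous_at_imp_continuous_on)
    then have "continuous_on {a..b} (\<lambda>x. R' ((x - s) / e))"
      by (rule continuous_on_compose2) (use e in \<open>auto intro!: continuous_intros\<close>)
    then have "continuous_on {a..b} \<psi>" unfolding \<psi>_def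
      using e by (intro continuous_on_divide continuous_on_const) auto
    then have ci: "continuous_on {a..b} (\<lambda>x. f x * \<psi> x)" using f by (intro continuous_intros)
    have \<psi>0: "\<psi> x \<ge> 0" for x using R(2) e by (simp add: \<psi>_def)
    have I1: "(\<psi> has_integral (R ((b - s) / e) - R ((a - s) / e))) {a..b}"
    proof (rule fundamental_theorem_of_calculus)
      show "((\<lambda>x. R ((x - s) / e)) has_vector_derivative \<psi> x) (at x within {a..b})" for x
        unfolding has_real_derivative_iff_has_vector_derivative[symmetric] \<psi>_def
      proof -
        have "((\<lambda>x. (x - s) / e) has_real_derivative 1 / e) (at x)"
          using e by (auto intro!: derivative_eq_intros)
        from DERIV_chain2[OF R(1) this]
        show "((\<lambda>x. R ((x - s) / e)) has_real_derivative R' ((x - s) / e) / e) (at x within {a..b})"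
          by (simp add: has_field_derivative_at_within)
      qed
    qed (use s in simp)
    have "(b - s) / e \<ge> 1" "(a - s) / e \<le> 0" using e s by (auto simp: field_simps)
    with I1 have I: "(\<psi> has_integral 1) {a..b}" by (simp add: R(5,6))
    have If: "(\<lambda>x. f x * \<psi> x) integrable_on {a..b}" using ci by (rule integrable_continuous_real)
    have "integrable (lebesgue_on {a<..<b}) (\<lambda>x. f x * \<psi> x)"
      by (rule continuous_imp_integrable_Ioo[OF ci])
    then have L: "(LINT x|lebesgue_on {a<..<b}. f x * \<psi> x) = integral {a..b} (\<lambda>x. f x * \<psi> x)"
      by (subst lebesgue_integral_eq_integral) (auto simp: integral_open_interval_real)
    have "((\<lambda>x. f x * \<psi> x - f s * \<psi> x) has_integral integral {a..b} (\<lambda>x. f x * \<psi> x) - f s * 1) {a..b}"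
      by (intro has_integral_diff has_integral_mult_right I integrable_integral If)
    then have D: "(\<lambda>x. f x * \<psi> x - f s * \<psi> x) integrable_on {a..b}"
      "integral {a..b} (\<lambda>x. f x * \<psi> x - f s * \<psi> x) = integral {a..b} (\<lambda>x. f x * \<psi> x) - f s"
      by (simp_all only: has_integral_integrable integral_unique mult_1_right)
    have I2: "((\<lambda>x. r / 2 * \<psi> x) has_integral r / 2 * 1) {a..b}"
      by (rule has_integral_mult_right[OF I])
    have "norm (integral {a..b} (\<lambda>x. f x * \<psi> x - f s * \<psi> x)) \<le> integral {a..b} (\<lambda>x. r / 2 * \<psi> x)"
    proof (rule integral_norm_bound_integral[OF D(1)])
      show "(\<lambda>x. r / 2 * \<psi> x) integrable_on {a..b}" using I2 by blast
      show "norm (f x * \<psi> x - f s * \<psi> x) \<le> r / 2 * \<psi> x" for x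
      proof (cases "\<psi> x = 0")
        case False
        then have "\<not> ((x - s) / e \<le> 0 \<or> (x - s) / e \<ge> 1)" using R(4) by (auto simp: \<psi>_def)
        then have "\<bar>x - s\<bar> < d" using e by (auto simp: field_simps)
        then have "\<bar>f x - f s\<bar> * \<psi> x \<le> r / 2 * \<psi> x" using d \<psi>0 by (intro mult_right_mono) (auto simp: less_imp_le)
        then show ?thesis using \<psi>0[of x] by (simp add: left_diff_distrib[symmetric] abs_mult)
      qed simp
    qed
    also have "\<dots> = r / 2" using integral_unique[OF I2] by simp
    finally have "norm ((LINT x|lebesgue_on {a<..<b}. f x * \<psi> x) - f s) < r"
      using \<open>r > 0\<close> unfolding L D(2) by linarith
    then show "norm ((LINT x|lebesgue_on {a<..<b}. f x * (R' ((x - s) / \<epsilon> n) / \<epsilon> n)) - f s) < r"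
      unfolding \<psi>_def e_def .
  qed
qed

text \<open>Test the weak derivative against a smoothed indicator of \<open>[s,t]\<close>, whose derivative is the
  difference of two approximate identities, at \<open>s\<close> and at \<open>t\<close>.\<close>

lemma has_H1_deriv_integral_interior:
  fixes f g :: "real \<Rightarrow> real"
  assumes H: "has_H1_deriv a b f g" and f: "continuous_on {a..b} f"
    and st: "a < s" "s < t" "t < b"
  shows "f t - f s = integral {s..t} g"
proof -
  obtain R R' :: "real \<Rightarrow> real" where sm: "smooth_fun R" "smooth_fun R'"
    and R: "\<And>x. (R has_real_derivative R' x) (at x)" "\<And>x. R' x \<ge> 0"
    "\<And>x. x \<le> 0 \<or> x \<ge> 1 \<Longrightarrow> R' x = 0" "\<And>x. x \<le> 0 \<Longrightarrow> R x = 0" "\<And>x. x \<ge> 1 \<Longrightarrow> R x = 1" "mono R"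
    using smooth_step by metis
  define \<epsilon> where "\<epsilon> = (\<lambda>n. inverse (real (Suc n)))"
  have \<epsilon>: "\<epsilon> \<longlonglongrightarrow> 0" "\<And>n. \<epsilon> n > 0"
    unfolding \<epsilon>_def by (rule LIMSEQ_inverse_real_of_nat) simp
  define M where "M = lebesgue_on {a<..<b}"
  \<comment> \<open>A smooth step up starting at \<open>s\<close> minus one starting at
    \<open>t\<close>: supported in \<open>{s..t + \<epsilon> n}\<close> and convergent pointwise to
    the indicator of \<open>{s<..t}\<close>, as \<open>R 0 = 0\<close>.\<close>
  define \<phi> where "\<phi> = (\<lambda>n x. R ((x - s) / \<epsilon> n) - R ((x - t) / \<epsilon> n))"
  have sm\<phi>: "smooth_fun (\<phi> n)" for n
  proof -
    have "smooth_fun (\<lambda>x. R (1 / \<epsilon> n * x + - s / \<epsilon> n) + (-1) * R (1 / \<epsilon> n * x + - t / \<epsilon> n))"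
      by (intro smooth_fun.add smooth_fun.mult smooth_fun.const smooth_fun.affine[OF sm(1)])
    then show ?thesis by (simp add: \<phi>_def diff_divide_distrib)
  qed
  have R01: "0 \<le> R x" "R x \<le> 1" for x
    using monoD[OF R(6), of "min x 0" x] monoD[OF R(6), of x "max x 1"] R(4,5) by auto
  have \<phi>01: "0 \<le> \<phi> n x" "\<phi> n x \<le> 1" for n x
    using monoD[OF R(6), of "(x - t) / \<epsilon> n" "(x - s) / \<epsilon> n"] R01[of "(x - t) / \<epsilon> n"] R01[of "(x - s) / \<epsilon> n"]
      st \<epsilon>(2)[of n] by (auto simp: \<phi>_def divide_right_mono)
  have d\<phi>: "deriv (\<phi> n) = (\<lambda>x. R' ((x - s) / \<epsilon> n) / \<epsilon> n - R' ((x - t) / \<epsilon> n) / \<epsilon> n)" for n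
  proof (rule ext, rule DERIV_imp_deriv)
    fix x
    have "((\<lambda>x. R ((x - c) / \<epsilon> n)) has_real_derivative R' ((x - c) / \<epsilon> n) / \<epsilon> n) (at x)" for c
    proof -
      have "((\<lambda>x. (x - c) / \<epsilon> n) has_real_derivative 1 / \<epsilon> n) (at x)"
        using \<epsilon>(2)[of n] by (auto intro!: derivative_eq_intros)
      from DERIV_chain2[OF R(1) this] show ?thesis by simp
    qed
    then show "(\<phi> n has_real_derivative R' ((x - s) / \<epsilon> n) / \<epsilon> n - R' ((x - t) / \<epsilon> n) / \<epsilon> n) (at x)"
      unfolding \<phi>_def by (intro DERIV_diff)
  qed
  \<comment> \<open>The support reaches up to \<open>t + \<epsilon> n\<close>, so only late members
    of the sequence are test functions on (a,b).\<close>
  have "eventually (\<lambda>n. \<epsilon> n < b - t) sequentially"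
    by (rule order_tendstoD[OF \<epsilon>(1)]) (use st in auto)
  then have ev: "eventually (\<lambda>n. \<phi> n \<in> test_functions a b) sequentially"
  proof eventually_elim
    case (elim n)
    have "{x. \<phi> n x \<noteq> 0} \<subseteq> {s..t + \<epsilon> n}"
    proof (rule subsetI, rule ccontr)
      fix x assume x: "x \<in> {x. \<phi> n x \<noteq> 0}" "x \<notin> {s..t + \<epsilon> n}"
      have "R ((x - s) / \<epsilon> n) = R ((x - t) / \<epsilon> n)"
      proof (cases "x < s")
        case True
        then have "(x - s) / \<epsilon> n \<le> 0" "(x - t) / \<epsilon> n \<le> 0"
          using st \<epsilon>(2)[of n] by (auto simp: divide_le_0_iff)
        then show ?thesis by (simp add: R(4))
      next
        case False
        then have "(x - s) / \<epsilon> n \<ge> 1" "(x - t) / \<epsilon> n \<ge> 1"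
          using x st \<epsilon>(2)[of n] by (auto simp: field_simps)
        then show ?thesis by (simp add: R(5))
      qed
      then show False using x by (simp add: \<phi>_def)
    qed
    then have cl: "closure {x. \<phi> n x \<noteq> 0} \<subseteq> {s..t + \<epsilon> n}"
      by (intro closure_minimal) auto
    then have "compact (closure {x. \<phi> n x \<noteq> 0})"
      by (meson bounded_closed_interval bounded_subset closed_closure compact_eq_bounded_closed)
    moreover have "closure {x. \<phi> n x \<noteq> 0} \<subseteq> {a<..<b}" using cl elim st by force
    ultimately show ?case
      using smooth_fun_differentiable[OF sm\<phi>] by (simp add: test_functions_def)
  qed
  have cR': "continuous_on UNIV R'"
    using smooth_fun_isCont[OF sm(2)] by (simp add: continuous_at_imp_continuous_on)
  have int\<psi>: "integrable M (\<lambda>x. f x * (R' ((x - c) / \<epsilon> n) / \<epsilon> n))" for c n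
  proof -
    have "continuous_on {a..b} (\<lambda>x. f x * (R' ((x - c) / \<epsilon> n) / \<epsilon> n))"
      by (intro continuous_on_mult continuous_on_divide f continuous_on_const
          continuous_on_compose2[OF cR'] continuous_on_diff continuous_on_id)
        (use \<epsilon>(2)[of n] in auto)
    then show ?thesis unfolding M_def by (rule continuous_imp_integrable_Ioo)
  qed
  have "(\<lambda>n. (LINT x|M. f x * (R' ((x - s) / \<epsilon> n) / \<epsilon> n)) - (LINT x|M. f x * (R' ((x - t) / \<epsilon> n) / \<epsilon> n)))
      \<longlonglongrightarrow> f s - f t"
    unfolding M_def using st
    by (intro tendsto_diff tendsto_smooth_step_average[OF f _ _ \<epsilon> R(1,2) smooth_fun_isCont[OF sm(2)] R(3,4,5)]) auto
  moreover have "(LINT x|M. f x * deriv (\<phi> n) x) =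
      (LINT x|M. f x * (R' ((x - s) / \<epsilon> n) / \<epsilon> n)) - (LINT x|M. f x * (R' ((x - t) / \<epsilon> n) / \<epsilon> n))" for n
    unfolding d\<phi> using Bochner_Integration.integral_diff[OF int\<psi> int\<psi>, of s n t n]
    by (simp only: right_diff_distrib)
  ultimately have lim1: "(\<lambda>n. LINT x|M. f x * deriv (\<phi> n) x) \<longlonglongrightarrow> f s - f t" by simp
  have gabs: "g absolutely_integrable_on {a<..<b}"
    using has_H1_deriv_absolutely_integrable[OF H] by (simp add: absolutely_integrable_on_Icc_iff_Ioo)
  then have gint: "integrable M g" unfolding M_def by (rule absolutely_integrable_imp_integrable) simp
  have lim2: "(\<lambda>n. LINT x|M. g x * \<phi> n x) \<longlonglongrightarrow> (LINT x|M. (if x \<in> {s<..t} then g x else 0))"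
  proof (rule integral_dominated_convergence[where w="\<lambda>x. \<bar>g x\<bar>"])
    have "{s<..t} \<inter> space M \<in> sets M" by (auto simp: M_def sets_restrict_space)
    then show "(\<lambda>x. if x \<in> {s<..t} then g x else 0) \<in> borel_measurable M"
      using gint by (intro measurable_If_set) auto
    show "(\<lambda>x. g x * \<phi> n x) \<in> borel_measurable M" for n
    proof -
      have "continuous_on UNIV (\<phi> n)"
        using smooth_fun_isCont[OF sm\<phi>] by (simp add: continuous_at_imp_continuous_on)
      then have "continuous_on {a<..<b} (\<phi> n)" by (rule continuous_on_subset) simp
      then have "\<phi> n \<in> borel_measurable M" unfolding M_def
        by (rule continuous_imp_measurable_on_sets_lebesgue) simp
      then show ?thesis by (intro borel_measurable_times borel_measurable_integrable[OF gint])
    qed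
    show "integrable M (\<lambda>x. \<bar>g x\<bar>)" using gint by auto
    show "AE x in M. norm (g x * \<phi> n x) \<le> \<bar>g x\<bar>" for n
    proof (rule AE_I2)
      fix x
      have "\<bar>g x\<bar> * \<phi> n x \<le> \<bar>g x\<bar>" by (rule mult_left_le[OF \<phi>01(2)]) simp
      then show "norm (g x * \<phi> n x) \<le> \<bar>g x\<bar>" using \<phi>01(1)[of n x] by (simp add: abs_mult)
    qed
    show "AE x in M. (\<lambda>n. g x * \<phi> n x) \<longlonglongrightarrow> (if x \<in> {s<..t} then g x else 0)"
    proof (rule AE_I2)
      fix x
      have lR: "(\<lambda>n. R ((x - c) / \<epsilon> n)) \<longlonglongrightarrow> (if x > c then 1 else 0)" for c
      proof (cases "x > c")
        case True
        have "eventually (\<lambda>n. \<epsilon> n < x - c) sequentially"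
          by (rule order_tendstoD[OF \<epsilon>(1)]) (use True in auto)
        then have "eventually (\<lambda>n. R ((x - c) / \<epsilon> n) = 1) sequentially"
        proof eventually_elim
          case (elim n)
          then have "(x - c) / \<epsilon> n \<ge> 1" using \<epsilon>(2)[of n] by simp
          then show ?case by (rule R(5))
        qed
        then show ?thesis using True by (simp add: tendsto_eventually)
      next
        case False
        then have "(x - c) / \<epsilon> n \<le> 0" for n using \<epsilon>(2)[of n] by (auto simp: divide_le_0_iff)
        then show ?thesis using False by (simp add: R(4))
      qed
      have "(\<lambda>n. g x * \<phi> n x) \<longlonglongrightarrow> g x * ((if x > s then 1 else 0) - (if x > t then 1 else 0))"
        unfolding \<phi>_def by (intro tendsto_mult tendsto_const tendsto_diff lR)
      then show "(\<lambda>n. g x * \<phi> n x) \<longlonglongrightarrow> (if x \<in> {s<..t} then g x else 0)"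
        using st by (auto split: if_splits)
    qed
  qed
  have weak: "(LINT x|M. f x * deriv \<psi> x) = - (LINT x|M. g x * \<psi> x)"
    if "\<psi> \<in> test_functions a b" for \<psi>
    using H that unfolding has_H1_deriv_def M_def by blast
  have "eventually (\<lambda>n. (LINT x|M. f x * deriv (\<phi> n) x) = - (LINT x|M. g x * \<phi> n x)) sequentially"
    using ev by (rule eventually_mono) (rule weak)
  from LIMSEQ_unique[OF Lim_transform_eventually[OF lim1 this] tendsto_minus[OF lim2]]
  have "f s - f t = - (LINT x|M. (if x \<in> {s<..t} then g x else 0))" .
  also have "(LINT x|M. (if x \<in> {s<..t} then g x else 0)) = integral\<^sup>L (lebesgue_on {s<..t}) g"
    unfolding M_def using st by (intro Lebesgue_Measure.integral_restrict) auto
  also have "\<dots> = integral {s<..t} g"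
  proof (rule lebesgue_integral_eq_integral)
    have "g absolutely_integrable_on {s<..t}"
      by (rule set_integrable_subset[OF gabs]) (use st in auto)
    then show "integrable (lebesgue_on {s<..t}) g" by (rule absolutely_integrable_imp_integrable) simp
  qed simp
  also have "\<dots> = integral {s..t} g"
  proof (rule integral_subset_negligible)
    show "negligible ({s..t} - {s<..t})"
      by (rule negligible_subset[of "{s}"]) auto
  qed auto
  finally show ?thesis by simp
qed

text \<open>The difference \<open>F\<close> of \<open>f\<close> and the primitive of
  \<open>g\<close> is constant on the open interval by the interior case, and continuity carries
  this to the end points.\<close>

lemma has_H1_deriv_integral:
  fixes f g :: "real \<Rightarrow> real"
  assumes H: "has_H1_deriv a b f g" and f: "continuous_on {a..b} f" and "a < b"
    and st: "a \<le> s" "s \<le> t" "t \<le> b"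
  shows "f t - f s = integral {s..t} g"
proof -
  have int: "g integrable_on {a..b}"
    using has_H1_deriv_absolutely_integrable[OF H] by (rule set_lebesgue_integral_eq_integral)
  define F where "F = (\<lambda>x. f x - integral {a..x} g)"
  have int': "g integrable_on {a..x}" if "x \<le> b" for x
    using that by (intro integrable_on_subinterval[OF int]) auto
  have split: "integral {a..x} g + integral {x..y} g = integral {a..y} g"
    if "a \<le> x" "x \<le> y" "y \<le> b" for x y
    using that by (intro Henstock_Kurzweil_Integration.integral_combine int')
  have "continuous_on {a..b} F"
    unfolding F_def by (intro continuous_intros f indefinite_integral_continuous_1 int)
  have eq: "F y = F x" if "a < x" "x < y" "y < b" for x y
    using has_H1_deriv_integral_interior[OF H f that] split[of x y] that by (simp add: F_def)
  define m where "m = (a + b) / 2"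
  have m: "a < m" "m < b" using \<open>a < b\<close> by (auto simp: m_def)
  have inner: "F x = F m" if "x \<in> {a<..<b}" for x
    using that m eq[of x m] eq[of m x] by (cases x m rule: linorder_cases) auto
  have "F x = F m" if "x \<in> {a..b}" for x
    by (rule continuous_constant_on_closure[of "{a<..<b}"])
      (use \<open>continuous_on {a..b} F\<close> \<open>a < b\<close> that inner in auto)
  then have "F t = F s" using st by auto
  then show ?thesis using split[OF st] by (simp add: F_def)
qed

section \<open>The maximum principle\<close>

text \<open>The kernel is nondecreasing in \<open>s\<close>, so the second mean value theorem evaluates the integral
  without differentiating the kernel.\<close>

lemma ABC_deriv_mean_value:
  fixes a b \<alpha> t :: real and B u :: "real \<Rightarrow> real"
  defines "w \<equiv> mittag_leffler \<alpha> (- (\<alpha> / (1 - \<alpha>)) * (t - a) powr \<alpha>)"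
  assumes \<alpha>: "0 < \<alpha>" "\<alpha> < 1" and u: "u \<in> H1 a b" "continuous_on {a..b} u"
    and t: "t \<in> {a<..b}"
  obtains c where "c \<in> {a..t}" "0 < w" "w \<le> 1"
    "ABC_deriv B \<alpha> a b u t = B \<alpha> / (1 - \<alpha>) * (w * (u c - u a) + (u t - u c))"
proof -
  define g where "g = H1_deriv a b u"
  have "\<exists>g. has_H1_deriv a b u g" using u(1) by (simp add: H1_def)
  then have H: "has_H1_deriv a b u g" unfolding g_def H1_deriv_def by (rule someI_ex)
  have "a < b" using t by simp
  note gint = has_H1_deriv_integral[OF H u(2) this]
  have gabs: "g absolutely_integrable_on {a..t}"
    by (rule set_integrable_subset[OF has_H1_deriv_absolutely_integrable[OF H]]) (use t in auto)
  define l where "l = \<alpha> / (1 - \<alpha>)"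
  have l: "l > 0" using \<alpha> by (simp add: l_def)
  define k where "k = (\<lambda>s. mittag_leffler \<alpha> (- l * (t - s) powr \<alpha>))"
  have ML0: "mittag_leffler \<alpha> 0 = 1" by (simp add: mittag_leffler_eq mittag_leffler2_0)
  have kt: "k t = 1" by (simp add: k_def ML0)
  have ka: "k a = w" by (simp add: k_def w_def l_def)
  have kpos: "k s > 0" for s
    unfolding k_def using \<alpha> l by (intro mittag_leffler_pos) auto
  have kmono: "k x \<le> k y" if "a \<le> x" "x \<le> y" "y \<le> t" for x y
    unfolding k_def
  proof (rule mittag_leffler_mono)
    have "(t - y) powr \<alpha> \<le> (t - x) powr \<alpha>" using \<alpha> that by (intro powr_mono2) auto
    then show "- l * (t - x) powr \<alpha> \<le> - l * (t - y) powr \<alpha>" using l by simp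
  qed (use \<alpha> l in auto)
  have "continuous_on UNIV (mittag_leffler \<alpha>)"
    using DERIV_mittag_leffler[OF \<alpha>(1)] by (intro continuous_at_imp_continuous_on ballI DERIV_isCont)
  moreover have "continuous_on {a..t} (\<lambda>s. - l * (t - s) powr \<alpha>)"
    using \<alpha> by (intro continuous_intros continuous_on_powr') auto
  ultimately have "continuous_on {a..t} k"
    unfolding k_def by (rule continuous_on_compose2) simp
  then have kmeas: "k \<in> borel_measurable (lebesgue_on {a..t})"
    by (rule continuous_imp_measurable_on_sets_lebesgue) simp
  have "bounded (k ` {a..t})"
    unfolding bounded_iff using kpos kmono[of _ t] kt by (intro exI[of _ 1]) (auto simp: less_imp_le)
  then have "(\<lambda>s. k s * g s) absolutely_integrable_on {a..t}"
    using kmeas gabs by (intro absolutely_integrable_bounded_measurable_product_real) auto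
  then have "integrable (lebesgue_on {a..t}) (\<lambda>s. k s * g s)"
    by (rule absolutely_integrable_imp_integrable) simp
  then have L: "(LINT s|lebesgue_on {a..t}. k s * g s) = integral {a..t} (\<lambda>s. k s * g s)"
    by (rule lebesgue_integral_eq_integral) simp
  have "a \<le> t" using t by simp
  obtain c where c: "c \<in> {a..t}"
    and "((\<lambda>s. k s * g s) has_integral (k a * integral {a..c} g + k t * integral {c..t} g)) {a..t}"
    by (rule second_mean_value_theorem_full[OF set_lebesgue_integral_eq_integral(1)[OF gabs] \<open>a \<le> t\<close> kmono])
  \<comment> \<open>The fundamental theorem turns both integrals of \<open>g\<close> into increments
    of \<open>u\<close>.\<close>
  then have "integral {a..t} (\<lambda>s. k s * g s) = w * (u c - u a) + (u t - u c)"
    using gint[of a c] gint[of c t] t by (simp add: integral_unique ka kt)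
  with L have "ABC_deriv B \<alpha> a b u t = B \<alpha> / (1 - \<alpha>) * (w * (u c - u a) + (u t - u c))"
    by (simp add: ABC_deriv_def k_def g_def l_def)
  moreover have "0 < w" "w \<le> 1" using kpos[of a] kmono[of a t] t ka kt by auto
  ultimately show thesis using that c by blast
qed

theorem lemma3p1:
  fixes a b \<alpha> :: real and B p u :: "real \<Rightarrow> real"
  assumes "normalization_function B"
    and "a < b"
    and "0 < \<alpha>" and "\<alpha> < 1"
    and "continuous_on {a..b} p"
    and "\<forall>t\<in>{a..b}. p t \<ge> 0"
    and "p a \<noteq> 0"
    and "u \<in> H1 a b"
    and "continuous_on {a..b} u"
    and "\<forall>t\<in>{a<..b}. ABC_deriv B \<alpha> a b u t + p t * u t \<le> 0"
  shows "\<forall>t\<in>{a..b}. u t \<le> 0"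
proof -
  define C where "C = B \<alpha> / (1 - \<alpha>)"
  have C: "C > 0" using assms(1,3,4) by (auto simp: C_def normalization_function_def)
  note mv = ABC_deriv_mean_value[OF assms(3,4,8,9), where B = B, folded C_def]
  \<comment> \<open>The differential inequality is available only to the right of \<open>a\<close>,
    so it is used at a point \<open>t\<close> near \<open>a\<close>, where the derivative is small
    and \<open>p t * u t\<close> is close to \<open>p a * u a\<close>.\<close>
  have ua: "u a \<le> 0"
  proof (rule ccontr)
    assume "\<not> u a \<le> 0"
    moreover have "p a > 0" using assms(2,6,7) by (auto simp: order_less_le)
    ultimately have m: "p a * u a > 0" by simp
    \<comment> \<open>The derivative will exceed \<open>- 3 * C * e\<close>, which is -3/8 of
      \<open>p a * u a\<close>, while \<open>p t * u t\<close> retains more than half of it; the sum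
      is then positive.\<close>
    define e where "e = p a * u a / (8 * C)"
    have e: "e > 0" using m C by (simp add: e_def)
    have "a \<in> {a..b}" using assms(2) by simp
    obtain d1 where d1: "d1 > 0" "\<And>x. x \<in> {a..b} \<Longrightarrow> \<bar>x - a\<bar> < d1 \<Longrightarrow> \<bar>u x - u a\<bar> < e"
      using assms(9)[unfolded continuous_on_iff dist_real_def, rule_format, OF \<open>a \<in> {a..b}\<close> e] by blast
    have "continuous_on {a..b} (\<lambda>x. p x * u x)" using assms(5,9) by (intro continuous_intros)
    from this[unfolded continuous_on_iff dist_real_def, rule_format, OF \<open>a \<in> {a..b}\<close> half_gt_zero[OF m]]
    obtain d2 where d2: "d2 > 0"
      "\<And>x. x \<in> {a..b} \<Longrightarrow> \<bar>x - a\<bar> < d2 \<Longrightarrow> \<bar>p x * u x - p a * u a\<bar> < p a * u a / 2" by blast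
    \<comment> \<open>The first bound keeps \<open>t \<le> b\<close>; halving gives strict distance
      below \<open>d1\<close> and \<open>d2\<close>. As \<open>c\<close> lies between
      \<open>a\<close> and \<open>t\<close>, it is near \<open>a\<close> as well.\<close>
    define t where "t = a + min (b - a) (min d1 d2 / 2)"
    have t: "t \<in> {a<..b}" "t < a + d1" "t < a + d2"
      using d1(1) d2(1) assms(2) by (auto simp: t_def min_def)
    obtain c w where c: "c \<in> {a..t}" "0 < w" "w \<le> 1"
      and eq: "ABC_deriv B \<alpha> a b u t = C * (w * (u c - u a) + (u t - u c))"
      using mv[OF t(1)] by metis
    have near: "\<bar>u c - u a\<bar> < e" "\<bar>u t - u a\<bar> < e" using c t by (auto intro!: d1(2))
    have "w * \<bar>u c - u a\<bar> \<le> 1 * e" using c near by (intro mult_mono) auto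
    then have "\<bar>w * (u c - u a)\<bar> \<le> e" using c by (simp add: abs_mult)
    then have "w * (u c - u a) + (u t - u c) > - (3 * e)" using near by linarith
    then have "ABC_deriv B \<alpha> a b u t > C * (- (3 * e))"
      unfolding eq using C by (rule mult_strict_left_mono)
    moreover have "C * (- (3 * e)) = - 3 / 8 * (p a * u a)" using C by (simp add: e_def)
    moreover have "\<bar>p t * u t - p a * u a\<bar> < p a * u a / 2" using t by (intro d2(2)) auto
    moreover have "ABC_deriv B \<alpha> a b u t + p t * u t \<le> 0" using assms(10) t by blast
    ultimately show False using m by linarith
  qed
  obtain t0 where t0: "t0 \<in> {a..b}" and max: "\<And>t. t \<in> {a..b} \<Longrightarrow> u t \<le> u t0"
    using continuous_attains_sup[of "{a..b}" u] assms(2,9) by auto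
  have "u t0 \<le> 0"
  proof (rule ccontr)
    assume pos: "\<not> u t0 \<le> 0"
    then have t: "t0 \<in> {a<..b}" using ua t0 by (cases "t0 = a") auto
    obtain c w where c: "c \<in> {a..t0}" "0 < w" "w \<le> 1"
      and eq: "ABC_deriv B \<alpha> a b u t0 = C * (w * (u c - u a) + (u t0 - u c))"
      using mv[OF t] by metis
    \<comment> \<open>The bracket in \<open>eq\<close> equals
      \<open>(1 - w) * (u t0 - u c) + w * (u t0 - u a)\<close>. Maximality of \<open>u t0\<close>
      makes the first term nonnegative, and \<open>u a \<le> 0 < u t0\<close> makes the second
      positive.\<close>
    have "(1 - w) * (u t0 - u c) \<ge> 0" using c t max[of c] by simp
    moreover have "w * (u t0 - u a) > 0" using c pos ua by simp
    ultimately have "w * (u c - u a) + (u t0 - u c) > 0" by (simp add: algebra_simps)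
    then have "ABC_deriv B \<alpha> a b u t0 > 0" unfolding eq using C by simp
    moreover have "p t0 * u t0 \<ge> 0" using assms(6) t0 pos by simp
    moreover have "ABC_deriv B \<alpha> a b u t0 + p t0 * u t0 \<le> 0" using assms(10) t by blast
    ultimately show False by linarith
  qed
  then show ?thesis using max by (meson order_trans)
qed

end
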